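(* Let $f\colon\mathbb{R}^n\to\mathbb{R}$ be $\beta$-smooth and $\alpha$-strongly convex with $0<\alpha\le\beta$, let $f^*$ be its minimal value and $\kappa=\beta/\alpha$. Let $x_0\in\mathbb{R}^n$ be arbitrary and let $(x_k)$, $(c_k)$, $(v_k)$ be the sequences generated from $x_0$ by the Optimal Quadratic Averaging algorithm (described in the context). Then for every index $k\ge 0$ we have $v_k\le f^*\le f(x_k^+)$ and $$f(x_k^+)-v_k\le\left(1-\frac{1}{\sqrt{\kappa}}\right)^k\bigl(f(x_0^+)-v_0\bigr).$$
   Context: The norm $\|\cdot\|$ is Euclidean. "$f$ is $\beta$-smooth and $\alpha$-strongly convex" means $f$ is differentiable and for all $x,y\in\mathbb{R}^n$ $$f(x)+\langle\nabla f(x),y-x\rangle+\tfrac{\alpha}{2}\|y-x\|^2\le f(y)\le f(x)+\langle\nabla f(x),y-x\rangle+\tfrac{\beta}{2}\|y-x\|^2 .$$ For $x\in\mathbb{R}^n$ put $x^+:=x-\frac1\beta\nabla f(x)$ and $x^{++}:=x-\frac1\alpha\nabla f(x)$. For $x,y\in\mathbb{R}^n$, $\mathrm{line\_search}(x,y)$ denotes the (unique) minimizer of $f$ over the line $\{x+t(y-x):t\in\mathbb{R}\}$ (equal to $x$ if $x=y$). Optimal averaging of two quadratics: given $Q_A(x)=v_A+\frac{\alpha}{2}\|x-x_A\|^2$ and $Q_B(x)=v_B+\frac{\alpha}{2}\|x-x_B\|^2$, for each $\lambda\in[0,1]$ the average $\lambda Q_A+(1-\lambda)Q_B$ has the form $v_\lambda+\frac{\alpha}{2}\|\cdot-c_\lambda\|^2$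 with $c_\lambda=\lambda x_A+(1-\lambda)x_B$ and $v_\lambda=v_B+\left(v_A-v_B+\frac\alpha2\|x_A-x_B\|^2\right)\lambda-\frac\alpha2\|x_A-x_B\|^2\lambda^2$. The optimal averaging of $Q_A$ and $Q_B$ is $\bar v+\frac{\alpha}{2}\|\cdot-\bar c\|^2$ with $\bar v=v_{\bar\lambda}$, $\bar c=c_{\bar\lambda}$, where $\bar\lambda$ maximizes $v_\lambda$ over $\lambda\in[0,1]$; if $x_A\neq x_B$, then $\bar\lambda$ is the projection onto $[0,1]$ of $\frac12+\frac{v_A-v_B}{\alpha\|x_A-x_B\|^2}$. Optimal Quadratic Averaging algorithm: set $v_0=f(x_0)-\frac{\|\nabla f(x_0)\|^2}{2\alpha}$, $c_0=x_0^{++}$ and $Q_0(x)=v_0+\frac\alpha2\|x-c_0\|^2$. For $k=1,2,\dots$: set $x_k=\mathrm{line\_search}(c_{k-1},x_{k-1}^+)$; set $Q(x)=\left(f(x_k)-\frac{\|\nabla f(x_k)\|^2}{2\alpha}\right)+\frac\alpha2\|x-x_k^{++}\|^2$; let $Q_k(x)=v_k+\frac\alpha2\|x-c_k\|^2$ be the optimal averaging of $Q$ and $Q_{k-1}$. *)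

theory Defs
  imports "HOL-Analysis.Analysis"
begin

definition gradient :: "('a::real_inner \<Rightarrow> real) \<Rightarrow> 'a \<Rightarrow> 'a" where
  "gradient f x = (THE g. GDERIV f x :> g)"

definition smooth_strongly_convex :: "real \<Rightarrow> real \<Rightarrow> ('a::real_inner \<Rightarrow> real) \<Rightarrow> bool" where
  "smooth_strongly_convex \<beta> \<alpha> f \<longleftrightarrow>
     (\<forall>x. f differentiable (at x)) \<and>
     (\<forall>x y. f x + gradient f x \<bullet> (y - x) + \<alpha> / 2 * (norm (y - x))\<^sup>2 \<le> f y \<and>
            f y \<le> f x + gradient f x \<bullet> (y - x) + \<beta> / 2 * (norm (y - x))\<^sup>2)"

definition minimal_value :: "('a \<Rightarrow> real) \<Rightarrow> real" where
  "minimal_value f = (LEAST m. m \<in> range f)"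

text \<open>With step parameter \<open>\<beta>\<close> this is $x^{+}$, with step parameter \<open>\<alpha>\<close> it is $x^{++}$.\<close>

definition gradient_step :: "('a::real_inner \<Rightarrow> real) \<Rightarrow> real \<Rightarrow> 'a \<Rightarrow> 'a" where
  "gradient_step f \<gamma> x = x - (1 / \<gamma>) *\<^sub>R gradient f x"

definition line_search :: "('a::real_inner \<Rightarrow> real) \<Rightarrow> 'a \<Rightarrow> 'a \<Rightarrow> 'a" where
  "line_search f x y =
     (THE z. is_arg_min f (\<lambda>w. w \<in> range (\<lambda>t::real. x + t *\<^sub>R (y - x))) z)"

text \<open>A quadratic $v + \frac{\alpha}{2}\|\cdot - c\|^2$ with the curvature \<open>\<alpha>\<close> fixed is represented
  by its minimal value \<open>v\<close> and its minimizer \<open>c\<close>; the weight \<open>l\<close> belongs to the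
  first quadratic \<open>(vA, xA)\<close>.\<close>

definition quadratic :: "real \<Rightarrow> real \<Rightarrow> 'a::real_inner \<Rightarrow> 'a \<Rightarrow> real" where
  "quadratic \<alpha> v c x = v + \<alpha> / 2 * (norm (x - c))\<^sup>2"

definition average_center :: "'a::real_inner \<Rightarrow> 'a \<Rightarrow> real \<Rightarrow> 'a" where
  "average_center xA xB l = l *\<^sub>R xA + (1 - l) *\<^sub>R xB"

definition average_value :: "real \<Rightarrow> real \<Rightarrow> 'a::real_inner \<Rightarrow> real \<Rightarrow> 'a \<Rightarrow> real \<Rightarrow> real" where
  "average_value \<alpha> vA xA vB xB l =
     vB + (vA - vB + \<alpha> / 2 * (norm (xA - xB))\<^sup>2) * l - \<alpha> / 2 * (norm (xA - xB))\<^sup>2 * l\<^sup>2"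

lemma average_quadratic:
  "l * quadratic \<alpha> vA xA x + (1 - l) * quadratic \<alpha> vB xB x =
     quadratic \<alpha> (average_value \<alpha> vA xA vB xB l) (average_center xA xB l) x"
  unfolding quadratic_def average_value_def average_center_def power2_norm_eq_inner
  by (simp add: inner_diff_left inner_diff_right inner_add_left inner_add_right inner_commute
      algebra_simps power2_eq_square) (simp add: field_simps)

text \<open>Relational because the maximizing weight is not unique when the two quadratics coincide;
  the resulting \<open>v\<close> and \<open>c\<close> are unique nevertheless.\<close>

definition optimal_averaging ::
  "real \<Rightarrow> real \<Rightarrow> 'a::real_inner \<Rightarrow> real \<Rightarrow> 'a \<Rightarrow> real \<Rightarrow> 'a \<Rightarrow> bool" where
  "optimal_averaging \<alpha> vA xA vB xB v c \<longleftrightarrow>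
     (\<exists>l. is_arg_max (average_value \<alpha> vA xA vB xB) (\<lambda>l. l \<in> {0..1}) l \<and>
          v = average_value \<alpha> vA xA vB xB l \<and> c = average_center xA xB l)"

text \<open>Minimal value of the quadratic lower bound of \<open>f\<close> at \<open>x\<close> given by strong convexity;
  its minimizer is \<open>gradient_step f \<alpha> x\<close>.\<close>

definition lower_value :: "('a::real_inner \<Rightarrow> real) \<Rightarrow> real \<Rightarrow> 'a \<Rightarrow> real" where
  "lower_value f \<alpha> x = f x - (norm (gradient f x))\<^sup>2 / (2 * \<alpha>)"

definition optimal_quadratic_averaging ::
  "('a::real_inner \<Rightarrow> real) \<Rightarrow> real \<Rightarrow> real \<Rightarrow> 'a \<Rightarrow>
   (nat \<Rightarrow> 'a) \<Rightarrow> (nat \<Rightarrow> 'a) \<Rightarrow> (nat \<Rightarrow> real) \<Rightarrow> bool" where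
  "optimal_quadratic_averaging f \<beta> \<alpha> x0 x c v \<longleftrightarrow>
     x 0 = x0 \<and> v 0 = lower_value f \<alpha> x0 \<and> c 0 = gradient_step f \<alpha> x0 \<and>
     (\<forall>k\<ge>1. x k = line_search f (c (k - 1)) (gradient_step f \<beta> (x (k - 1))) \<and>
            optimal_averaging \<alpha>
              (lower_value f \<alpha> (x k)) (gradient_step f \<alpha> (x k))
              (v (k - 1)) (c (k - 1))
              (v k) (c k))"

text \<open>A run exists from every starting point, also when the maximizing weights are not unique.\<close>

lemma optimal_averaging_exists: "\<exists>v c. optimal_averaging \<alpha> vA xA vB xB v c"
proof -
  have "continuous_on {0..1} (average_value \<alpha> vA xA vB xB)"
    unfolding average_value_def by (intro continuous_intros)
  then obtain l where "l \<in> {0..1::real}"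
      "\<forall>l'\<in>{0..1}. average_value \<alpha> vA xA vB xB l' \<le> average_value \<alpha> vA xA vB xB l"
    using continuous_attains_sup[of "{0..1::real}" "average_value \<alpha> vA xA vB xB"] by auto
  then have "is_arg_max (average_value \<alpha> vA xA vB xB) (\<lambda>l. l \<in> {0..1}) l"
    by (auto simp: is_arg_max_linorder)
  then show ?thesis
    unfolding optimal_averaging_def by blast
qed

lemma optimal_quadratic_averaging_exists:
  "\<exists>x c v. optimal_quadratic_averaging f \<beta> \<alpha> x0 x c v"
proof -
  let ?R = "\<lambda>s s'. fst s' = line_search f (fst (snd s)) (gradient_step f \<beta> (fst s)) \<and>
      optimal_averaging \<alpha> (lower_value f \<alpha> (fst s')) (gradient_step f \<alpha> (fst s'))
        (snd (snd s)) (fst (snd s)) (snd (snd s')) (fst (snd s'))"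
  have step: "\<exists>s'. ?R s s'" for s
  proof -
    let ?x = "line_search f (fst (snd s)) (gradient_step f \<beta> (fst s))"
    obtain v c where "optimal_averaging \<alpha> (lower_value f \<alpha> ?x) (gradient_step f \<alpha> ?x)
        (snd (snd s)) (fst (snd s)) v c"
      using optimal_averaging_exists by blast
    then have "?R s (?x, c, v)" by simp
    then show ?thesis by blast
  qed
  define s where "s = rec_nat (x0, gradient_step f \<alpha> x0, lower_value f \<alpha> x0)
    (\<lambda>_ s. SOME s'. ?R s s')"
  have s0: "s 0 = (x0, gradient_step f \<alpha> x0, lower_value f \<alpha> x0)"
    by (simp add: s_def)
  have sk: "?R (s k) (s (Suc k))" for k
  proof -
    have "s (Suc k) = (SOME s'. ?R (s k) s')" by (simp add: s_def)
    then show ?thesis by (simp only:) (rule someI_ex[OF step])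
  qed
  have "?R (s (k - 1)) (s k)" if "k \<ge> 1" for k
    by (metis sk that le_add_diff_inverse plus_1_eq_Suc)
  then have "optimal_quadratic_averaging f \<beta> \<alpha> x0
      (\<lambda>k. fst (s k)) (\<lambda>k. fst (snd (s k))) (\<lambda>k. snd (snd (s k)))"
    unfolding optimal_quadratic_averaging_def s0 fst_conv snd_conv by blast
  then show ?thesis by blast
qed

end

theory Submission
  imports Defs
begin

text \<open>
  Two invariants are carried along a run. First, every \<open>Q\<^sub>k = v\<^sub>k + \<alpha>/2 \<parallel>\<cdot> - c\<^sub>k\<parallel>\<^sup>2\<close> minorizes \<open>f\<close>:
  strong convexity at \<open>x\<close>, after completing the square, says that the quadratic with minimal value
  \<open>f x - \<parallel>g\<parallel>\<^sup>2/(2\<alpha>)\<close> and minimizer \<open>x - g/\<alpha>\<close>, where \<open>g\<close> is the gradient at \<open>x\<close>, is a minorant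
  (\<open>strong_convexity_minorant\<close>), and minorants are closed under averaging
  (\<open>optimal_averaging_minorant\<close>). Hence \<open>v\<^sub>k\<close> bounds \<open>f\<close> from below.

  Second, the gap \<open>f (x\<^sub>k\<^sup>+) - v\<^sub>k\<close> contracts by \<open>1 - 1/\<surd>\<kappa>\<close> in each step (\<open>gap_contraction\<close>).
  Write \<open>x, v, c\<close> for the current iterate and the previous \<open>v, c\<close>. The line search makes \<open>g\<close>
  orthogonal to \<open>x - c\<close>, so by Pythagoras the two centers \<open>x - g/\<alpha>\<close> and \<open>c\<close> are at distance at least
  \<open>\<parallel>g\<parallel>/\<alpha>\<close>. The farther apart the centers, the larger the minimal value of an average, so the average
  with weight \<open>l\<close> has minimal value at least
  \<open>(1 - l) v + l f x - l\<^sup>2 \<parallel>g\<parallel>\<^sup>2/(2\<alpha>)\<close>, and the optimal one does at least as well for every \<open>l\<close>.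
  With \<open>l = 1/\<surd>\<kappa>\<close> the last term is \<open>\<parallel>g\<parallel>\<^sup>2/(2\<beta>)\<close>, which is exactly the decrease of \<open>f\<close>
  guaranteed by the step from \<open>x\<close> to \<open>x\<^sup>+\<close>; the two cancel, and the new gap is at most
  \<open>(1 - l) (f x - v)\<close>. The line search also makes \<open>f x\<close> at most \<open>f\<close> at the previous \<open>x\<^sup>+\<close>.

  That the minimal value and the line search, defined by description operators, are what they
  should be follows from compactness: a quadratic minorant confines small values of \<open>f\<close> to a ball.
\<close>

section \<open>Quadratic minorants\<close>

lemma smooth_strongly_convex_lower:
  "smooth_strongly_convex \<beta> \<alpha> f \<Longrightarrow>
    f x + gradient f x \<bullet> (y - x) + \<alpha> / 2 * (norm (y - x))\<^sup>2 \<le> f y"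
  unfolding smooth_strongly_convex_def by blast

lemma smooth_strongly_convex_upper:
  "smooth_strongly_convex \<beta> \<alpha> f \<Longrightarrow>
    f y \<le> f x + gradient f x \<bullet> (y - x) + \<beta> / 2 * (norm (y - x))\<^sup>2"
  unfolding smooth_strongly_convex_def by blast

lemma smooth_strongly_convex_continuous:
  "smooth_strongly_convex \<beta> \<alpha> f \<Longrightarrow> continuous_on S f"
  unfolding smooth_strongly_convex_def
  by (metis continuous_at_imp_continuous_on differentiable_imp_continuous_within)

lemma quadratic_ge_value: "0 < \<alpha> \<Longrightarrow> v \<le> quadratic \<alpha> v c x"
  unfolding quadratic_def by simp

lemma lower_quadratic_eq:
  assumes "0 < \<alpha>"
  shows "quadratic \<alpha> (lower_value f \<alpha> x) (gradient_step f \<alpha> x) y =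
    f x + gradient f x \<bullet> (y - x) + \<alpha> / 2 * (norm (y - x))\<^sup>2"
proof -
  let ?g = "gradient f x"
  have center: "y - gradient_step f \<alpha> x = (y - x) + (1 / \<alpha>) *\<^sub>R ?g"
    by (simp add: gradient_step_def)
  have "(norm (y - gradient_step f \<alpha> x))\<^sup>2 =
      (norm (y - x))\<^sup>2 + 2 / \<alpha> * (?g \<bullet> (y - x)) + (norm ?g)\<^sup>2 / \<alpha>\<^sup>2"
    unfolding center power2_norm_eq_inner
    by (simp add: inner_add_left inner_add_right inner_commute power2_eq_square)
  with assms show ?thesis
    unfolding quadratic_def lower_value_def
    by (simp add: field_simps power2_eq_square)
qed

lemma strong_convexity_minorant:
  assumes "0 < \<alpha>" and "smooth_strongly_convex \<beta> \<alpha> f"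
  shows "quadratic \<alpha> (lower_value f \<alpha> x) (gradient_step f \<alpha> x) y \<le> f y"
  using smooth_strongly_convex_lower[OF assms(2)] lower_quadratic_eq[OF assms(1)] by metis

lemma optimal_averaging_minorant:
  assumes "optimal_averaging \<alpha> vA xA vB xB v c"
    and "quadratic \<alpha> vA xA y \<le> m" and "quadratic \<alpha> vB xB y \<le> m"
  shows "quadratic \<alpha> v c y \<le> m"
proof -
  obtain l where l: "l \<in> {0..1}" and v: "v = average_value \<alpha> vA xA vB xB l"
    and c: "c = average_center xA xB l"
    using assms(1) unfolding optimal_averaging_def is_arg_max_def by blast
  have "quadratic \<alpha> v c y = l * quadratic \<alpha> vA xA y + (1 - l) * quadratic \<alpha> vB xB y"
    unfolding v c average_quadratic ..
  also have "\<dots> \<le> m"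
    using l assms(2,3) by (intro convex_bound_le) auto
  finally show ?thesis .
qed

section \<open>Existence of minimizers\<close>

text \<open>Outside a ball around \<open>c\<close> the minorant, and with it \<open>f\<close>, exceeds \<open>f s\<close> for a chosen point
  \<open>s\<close> of \<open>S\<close>; only a compact part of \<open>S\<close> is left.\<close>

lemma minorized_attains_min:
  fixes f :: "'a::euclidean_space \<Rightarrow> real"
  assumes "0 < \<alpha>" and "continuous_on S f" and "closed S" and "S \<noteq> {}"
    and minorant: "\<And>x. quadratic \<alpha> v c x \<le> f x"
  shows "\<exists>z\<in>S. \<forall>w\<in>S. f z \<le> f w"
proof -
  obtain s where s: "s \<in> S" using assms(4) by blast
  define R where "R = sqrt (2 * (f s - v) / \<alpha>)"
  have ball: "w \<in> cball c R" if "f w \<le> f s" for w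
  proof -
    have "\<alpha> / 2 * (norm (w - c))\<^sup>2 \<le> f s - v"
      using minorant[of w] that unfolding quadratic_def by linarith
    then have "(norm (w - c))\<^sup>2 \<le> 2 * (f s - v) / \<alpha>"
      using assms(1) by (simp add: field_simps)
    then show ?thesis
      unfolding R_def by (simp add: dist_norm norm_minus_commute real_le_rsqrt)
  qed
  have "compact (S \<inter> cball c R)"
    using assms(3) by (simp add: closed_Int_compact)
  moreover have "continuous_on (S \<inter> cball c R) f"
    using assms(2) by (rule continuous_on_subset) simp
  moreover have sK: "s \<in> S \<inter> cball c R"
    using s ball[of s] by simp
  ultimately obtain z where z: "z \<in> S \<inter> cball c R" "\<forall>w\<in>S \<inter> cball c R. f z \<le> f w"
    using continuous_attains_inf[of "S \<inter> cball c R" f] by blast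
  have "f z \<le> f w" if "w \<in> S" for w
  proof (cases "f w \<le> f s")
    case True
    with z(2) that ball show ?thesis by blast
  next
    case False
    moreover have "f z \<le> f s" using z(2) sK by blast
    ultimately show ?thesis by linarith
  qed
  with z(1) show ?thesis by blast
qed

lemma minimal_value_attained:
  fixes f :: "'a::euclidean_space \<Rightarrow> real"
  assumes "0 < \<alpha>" and "smooth_strongly_convex \<beta> \<alpha> f"
  shows "\<exists>z. minimal_value f = f z \<and> (\<forall>w. f z \<le> f w)"
proof -
  obtain z where z: "\<forall>w. f z \<le> f w"
    using minorized_attains_min[OF assms(1) smooth_strongly_convex_continuous[OF assms(2)]
        closed_UNIV UNIV_not_empty strong_convexity_minorant[OF assms, of 0]] by blast
  have "minimal_value f = f z"
    unfolding minimal_value_def using z by (intro Least_equality) auto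
  with z show ?thesis by blast
qed

section \<open>Exact line search\<close>

text \<open>Smoothness turns minimality along the direction \<open>d\<close> into nonnegativity of the quadratic
  polynomial \<open>t (g \<bullet> d) + t\<^sup>2 \<beta>/2 \<parallel>d\<parallel>\<^sup>2\<close> in \<open>t\<close>, which vanishes at \<open>t = 0\<close>; its linear
  coefficient must be zero.\<close>

lemma minimizer_gradient_orthogonal:
  assumes "0 < \<beta>" and "smooth_strongly_convex \<beta> \<alpha> f"
    and min: "\<And>t. f z \<le> f (z + t *\<^sub>R d)"
  shows "gradient f z \<bullet> d = 0"
proof (cases "d = 0")
  case False
  define p where "p = gradient f z \<bullet> d"
  define q where "q = \<beta> * (norm d)\<^sup>2"
  have q: "0 < q" using assms(1) False by (simp add: q_def)
  (* The minimizer of the polynomial, where its value is - p^2 / (2 q). *)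
  define t where "t = - p / q"
  have "f z \<le> f z + t * p + q / 2 * t\<^sup>2"
    using order_trans[OF min[of t] smooth_strongly_convex_upper[OF assms(2), of "z + t *\<^sub>R d" z]]
    by (simp add: p_def q_def power_mult_distrib algebra_simps)
  then have "p\<^sup>2 \<le> 0"
    using q by (simp add: t_def field_simps power2_eq_square)
  then show ?thesis by (simp add: p_def)
qed simp

text \<open>Strong convexity at a minimizer \<open>z\<close> on the line, where the gradient is orthogonal to the line,
  bounds \<open>f w - f z\<close> below by \<open>\<alpha>/2 \<parallel>w - z\<parallel>\<^sup>2\<close>, so there is no other minimizer and the definite
  description denotes.\<close>

lemma line_search_is_arg_min:
  fixes f :: "'a::euclidean_space \<Rightarrow> real"
  assumes "0 < \<alpha>" and "0 < \<beta>" and f: "smooth_strongly_convex \<beta> \<alpha> f"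
  shows "is_arg_min f (\<lambda>w. w \<in> range (\<lambda>t. x + t *\<^sub>R (y - x))) (line_search f x y)"
    and "gradient f (line_search f x y) \<bullet> (y - x) = 0"
proof -
  let ?d = "y - x"
  let ?L = "range (\<lambda>t. x + t *\<^sub>R ?d)"
  let ?min = "is_arg_min f (\<lambda>w. w \<in> ?L)"
  have "?L = affine hull {x, y}"
  proof -
    have "?L = range (\<lambda>t. (1 - t) *\<^sub>R x + t *\<^sub>R y)"
      by (rule arg_cong[of _ _ range]) (auto simp: algebra_simps)
    also have "\<dots> = affine hull {x, y}"
      unfolding affine_hull_2_alt by (rule arg_cong[of _ _ range]) (auto simp: algebra_simps)
    finally show ?thesis .
  qed
  then have "closed ?L" by simp
  then obtain z where z: "?min z"
    using minorized_attains_min[OF assms(1) smooth_strongly_convex_continuous[OF f] _ _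
        strong_convexity_minorant[OF assms(1) f, of 0], of ?L]
    by (auto simp: is_arg_min_linorder)
  have orth: "gradient f z \<bullet> ?d = 0" if "?min z" for z
  proof (rule minimizer_gradient_orthogonal[OF assms(2) f])
    fix t
    obtain s where "z = x + s *\<^sub>R ?d" using \<open>?min z\<close> by (auto simp: is_arg_min_def)
    then have "z + t *\<^sub>R ?d = x + (s + t) *\<^sub>R ?d" by (simp add: scaleR_add_left)
    then have "z + t *\<^sub>R ?d \<in> ?L" by blast
    with \<open>?min z\<close> show "f z \<le> f (z + t *\<^sub>R ?d)" by (simp add: is_arg_min_linorder)
  qed
  have unique: "w = z" if "?min w" for w
  proof -
    obtain s t where "z = x + s *\<^sub>R ?d" and "w = x + t *\<^sub>R ?d"
      using z \<open>?min w\<close> by (auto simp: is_arg_min_def)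
    then have "w - z = (t - s) *\<^sub>R ?d" by (simp add: scaleR_diff_left)
    then have "gradient f z \<bullet> (w - z) = 0" using orth[OF z] by simp
    moreover have "f w \<le> f z" using z \<open>?min w\<close> by (simp add: is_arg_min_linorder)
    ultimately have "\<alpha> / 2 * (norm (w - z))\<^sup>2 \<le> 0"
      using smooth_strongly_convex_lower[OF f, of z w] by linarith
    with assms(1) show ?thesis by (simp add: mult_le_0_iff)
  qed
  have "line_search f x y = z"
    unfolding line_search_def using z unique by (rule the_equality)
  with z orth[OF z] show "?min (line_search f x y)" "gradient f (line_search f x y) \<bullet> ?d = 0"
    by simp_all
qed

lemma line_search_gradient_orthogonal:
  fixes f :: "'a::euclidean_space \<Rightarrow> real"
  assumes "0 < \<alpha>" and "0 < \<beta>" and "smooth_strongly_convex \<beta> \<alpha> f"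
  shows "gradient f (line_search f x y) \<bullet> (line_search f x y - x) = 0"
proof -
  obtain t where "line_search f x y = x + t *\<^sub>R (y - x)"
    using line_search_is_arg_min(1)[OF assms, of x y] by (auto simp: is_arg_min_def)
  then have "line_search f x y - x = t *\<^sub>R (y - x)" by simp
  then show ?thesis using line_search_is_arg_min(2)[OF assms, of x y] by simp
qed

lemma line_search_le:
  fixes f :: "'a::euclidean_space \<Rightarrow> real"
  assumes "0 < \<alpha>" and "0 < \<beta>" and "smooth_strongly_convex \<beta> \<alpha> f"
  shows "f (line_search f x y) \<le> f y"
proof -
  have "y = x + 1 *\<^sub>R (y - x)" by simp
  then have "y \<in> range (\<lambda>t. x + t *\<^sub>R (y - x))" by blast
  then show ?thesis
    using line_search_is_arg_min(1)[OF assms, of x y] by (simp add: is_arg_min_linorder)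
qed

section \<open>Contraction of the gap\<close>

lemma gradient_step_decrease:
  assumes "0 < \<beta>" and "smooth_strongly_convex \<beta> \<alpha> f"
  shows "f (gradient_step f \<beta> x) \<le> f x - (norm (gradient f x))\<^sup>2 / (2 * \<beta>)"
proof -
  have step: "gradient_step f \<beta> x - x = - ((1 / \<beta>) *\<^sub>R gradient f x)"
    by (simp add: gradient_step_def)
  have "f (gradient_step f \<beta> x)
      \<le> f x - (norm (gradient f x))\<^sup>2 / \<beta> + \<beta> / 2 * ((norm (gradient f x))\<^sup>2 / \<beta>\<^sup>2)"
    using smooth_strongly_convex_upper[OF assms(2), of "gradient_step f \<beta> x" x]
    unfolding step by (simp add: power_divide power2_norm_eq_inner)
  then show ?thesis
    using assms(1) by (simp add: field_simps power2_eq_square)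
qed

lemma optimal_averaging_ge:
  assumes "optimal_averaging \<alpha> vA xA vB xB v c" and "l \<in> {0..1}"
  shows "average_value \<alpha> vA xA vB xB l \<le> v"
  using assms unfolding optimal_averaging_def by (auto simp: is_arg_max_linorder)

text \<open>By orthogonality the squared distance of the centers is
  \<open>\<parallel>x - c\<parallel>\<^sup>2 + \<parallel>g\<parallel>\<^sup>2/\<alpha>\<^sup>2\<close>, and it enters the averaged minimal value with the
  nonnegative factor \<open>\<alpha>/2 l (1 - l)\<close>; dropping \<open>\<parallel>x - c\<parallel>\<^sup>2\<close> leaves the bound.\<close>

lemma average_value_orthogonal_ge:
  assumes "0 < \<alpha>" and "0 \<le> l" and "l \<le> 1" and orth: "gradient f x \<bullet> (x - c) = 0"
  shows "(1 - l) * v + l * f x - l\<^sup>2 * (norm (gradient f x))\<^sup>2 / (2 * \<alpha>)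
    \<le> average_value \<alpha> (lower_value f \<alpha> x) (gradient_step f \<alpha> x) v c l"
proof -
  let ?g = "gradient f x"
  let ?h = "(norm (gradient_step f \<alpha> x - c))\<^sup>2"
  have center: "gradient_step f \<alpha> x - c = (x - c) - (1 / \<alpha>) *\<^sub>R ?g"
    by (simp add: gradient_step_def)
  have "?h = (norm (x - c))\<^sup>2 + (norm ?g)\<^sup>2 / \<alpha>\<^sup>2"
    using orth unfolding center power2_norm_eq_inner
    by (simp add: inner_diff_left[of "x - c"] inner_diff_right[of _ "x - c"]
        inner_commute[of "x - c" ?g] power2_eq_square)
  then have "(norm ?g)\<^sup>2 / \<alpha>\<^sup>2 \<le> ?h" by simp
  then have "\<alpha> / 2 * (l * (1 - l)) * ((norm ?g)\<^sup>2 / \<alpha>\<^sup>2) \<le> \<alpha> / 2 * (l * (1 - l)) * ?h"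
    using assms(1-3) by (intro mult_left_mono) auto
  moreover have "\<alpha> / 2 * (l * (1 - l)) * ((norm ?g)\<^sup>2 / \<alpha>\<^sup>2)
      = l * (norm ?g)\<^sup>2 / (2 * \<alpha>) - l\<^sup>2 * (norm ?g)\<^sup>2 / (2 * \<alpha>)"
    using assms(1) by (simp add: field_simps power2_eq_square)
  moreover have "average_value \<alpha> (lower_value f \<alpha> x) (gradient_step f \<alpha> x) v c l
      = (1 - l) * v + l * f x - l * (norm ?g)\<^sup>2 / (2 * \<alpha>) + \<alpha> / 2 * (l * (1 - l)) * ?h"
    unfolding average_value_def lower_value_def
    by (simp add: algebra_simps power2_eq_square) (simp add: field_simps)
  ultimately show ?thesis by linarith
qed

text \<open>The point \<open>y\<close> stands for the gradient step from the previous iterate. The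
  optimal average is compared with the one of fixed weight \<open>1/\<surd>\<kappa>\<close>.\<close>

lemma gap_contraction:
  fixes f :: "'a::euclidean_space \<Rightarrow> real"
  assumes "0 < \<alpha>" and "\<alpha> \<le> \<beta>" and f: "smooth_strongly_convex \<beta> \<alpha> f"
    and x: "x = line_search f c y"
    and opt: "optimal_averaging \<alpha> (lower_value f \<alpha> x) (gradient_step f \<alpha> x) v c v' c'"
  shows "f (gradient_step f \<beta> x) - v' \<le> (1 - 1 / sqrt (\<beta> / \<alpha>)) * (f y - v)"
proof -
  (* The weight for which l^2 / (2 \<alpha>) equals the factor 1 / (2 \<beta>) of the decrease. *)
  define l where "l = 1 / sqrt (\<beta> / \<alpha>)"
  have \<beta>: "0 < \<beta>" using assms(1,2) by linarith
  have l: "0 \<le> l" "l \<le> 1" using assms(1,2) by (auto simp: l_def)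
  have l2: "l\<^sup>2 = \<alpha> / \<beta>" using assms(1) \<beta> by (simp add: l_def power_divide)
  have "l\<^sup>2 * (norm (gradient f x))\<^sup>2 / (2 * \<alpha>) = (norm (gradient f x))\<^sup>2 / (2 * \<beta>)"
    unfolding l2 using assms(1) \<beta> by (simp add: field_simps)
  then have "(1 - l) * v + l * f x - (norm (gradient f x))\<^sup>2 / (2 * \<beta>) \<le> v'"
    using average_value_orthogonal_ge[OF assms(1) l, where f = f and x = x and c = c and v = v]
      line_search_gradient_orthogonal[OF assms(1) \<beta> f, where x = c and y = y]
      optimal_averaging_ge[OF opt, of l] l by (simp add: x)
  then have "f (gradient_step f \<beta> x) - v' \<le> f x - (1 - l) * v - l * f x"
    using gradient_step_decrease[OF \<beta> f, of x] by linarith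
  also have "\<dots> = (1 - l) * (f x - v)" by (simp add: algebra_simps)
  also have "\<dots> \<le> (1 - l) * (f y - v)"
    using line_search_le[OF assms(1) \<beta> f, of c y] l x by (intro mult_left_mono) auto
  finally show ?thesis unfolding l_def .
qed

section \<open>Convergence rate\<close>

theorem theorem2p3:
  fixes f :: "real ^ 'n \<Rightarrow> real" and \<alpha> \<beta> :: real and x0 :: "real ^ 'n"
    and x c :: "nat \<Rightarrow> real ^ 'n" and v :: "nat \<Rightarrow> real" and k :: nat
  assumes "0 < \<alpha>" and "\<alpha> \<le> \<beta>"
    and "smooth_strongly_convex \<beta> \<alpha> f"
    and "optimal_quadratic_averaging f \<beta> \<alpha> x0 x c v"
  shows "v k \<le> minimal_value f \<and> minimal_value f \<le> f (gradient_step f \<beta> (x k)) \<and>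
         f (gradient_step f \<beta> (x k)) - v k
           \<le> (1 - 1 / sqrt (\<beta> / \<alpha>)) ^ k * (f (gradient_step f \<beta> x0) - v 0)"
proof (intro conjI)
  have init: "x 0 = x0" "v 0 = lower_value f \<alpha> x0" "c 0 = gradient_step f \<alpha> x0"
    and step: "\<And>k. k \<ge> 1 \<Longrightarrow>
      x k = line_search f (c (k - 1)) (gradient_step f \<beta> (x (k - 1))) \<and>
      optimal_averaging \<alpha> (lower_value f \<alpha> (x k)) (gradient_step f \<alpha> (x k))
        (v (k - 1)) (c (k - 1)) (v k) (c k)"
    using assms(4) unfolding optimal_quadratic_averaging_def by blast+
  have iterate: "x (Suc k) = line_search f (c k) (gradient_step f \<beta> (x k))"
    and average: "optimal_averaging \<alpha> (lower_value f \<alpha> (x (Suc k)))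
      (gradient_step f \<alpha> (x (Suc k))) (v k) (c k) (v (Suc k)) (c (Suc k))" for k
    using step[of "Suc k"] unfolding One_nat_def diff_Suc_Suc diff_zero by blast+
  obtain z where z: "minimal_value f = f z" "\<And>w. f z \<le> f w"
    using minimal_value_attained[OF assms(1,3)] by blast
  have minorant: "quadratic \<alpha> (v k) (c k) y \<le> f y" for y
  proof (induction k)
    case 0
    show ?case using strong_convexity_minorant[OF assms(1,3)] by (simp add: init)
  next
    case (Suc k)
    show ?case
      using average strong_convexity_minorant[OF assms(1,3)] Suc.IH
      by (rule optimal_averaging_minorant)
  qed
  show "v k \<le> minimal_value f"
    using quadratic_ge_value[OF assms(1)] minorant[of z] z(1) by (metis order_trans)
  show "minimal_value f \<le> f (gradient_step f \<beta> (x k))"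
    using z by simp
  show "f (gradient_step f \<beta> (x k)) - v k
      \<le> (1 - 1 / sqrt (\<beta> / \<alpha>)) ^ k * (f (gradient_step f \<beta> x0) - v 0)"
  proof (induction k)
    case 0
    show ?case by (simp add: init)
  next
    case (Suc k)
    have "0 \<le> 1 - 1 / sqrt (\<beta> / \<alpha>)" using assms(1,2) by simp
    from order_trans[OF gap_contraction[OF assms(1-3) iterate average]
        mult_left_mono[OF Suc.IH this]]
    show ?case by (simp add: mult.assoc)
  qed
qed

end
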